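(* Let $f\colon P\to Q$ be a surjective quandle homomorphism and let $G=\mathrm{Aut}_{\mathrm{rel}}(f)$. Then $f$ factors as $f=h_G\circ\pi_G$ with surjective homomorphisms $\pi_G\colon P\to P/G$ (the quotient map) and $h_G\colon P/G\to Q$, where $\pi_G$ is homogeneous and $h_G$ is rigid.
   Context: A quandle is a set $Q$ with bijections $s_x\colon Q\to Q$ ($x\in Q$) such that $s_x(x)=x$ and $s_x\circ s_y=s_{s_x(y)}\circ s_x$ for all $x,y\in Q$. A quandle homomorphism $f\colon P\to Q$ is a map with $f(s_x(y))=s_{f(x)}(f(y))$ for all $x,y\in P$. $\mathrm{Aut}(P)$ is the group of bijective quandle endomorphisms of $P$, and $\mathrm{Inn}(P)\subseteq\mathrm{Aut}(P)$ is the subgroup generated by all $s_x$, $x\in P$. The relative automorphism group of $f$ is $\mathrm{Aut}_{\mathrm{rel}}(f)=\{\varphi\in\mathrm{Aut}(P)\mid f\circ\varphi=f\}$; for surjective $f$ it is normalized by $\mathrm{Inn}(P)$. The homomorphism $f$ is homogeneous if it is surjective and for each $q\in Q$ the group $\mathrm{Aut}_{\mathrm{rel}}(f)$ acts transitively on $f^{-1}(q)$. For a subgroup $G\subseteq\mathrm{Aut}(P)$ normalized by $\mathrm{Inn}(P)$, the set $P/G$ of $G$-orbits has a well-defined quandle structure $s_{[x]}([y])=[s_x(y)]$, and $\pi_G\colon P\to P/G$ is the natural quotient homomorphism. A surjective quandle homomorphism $f\colon P\to Q$ induces a surjective group homomorphism $f_*\colon\mathrm{Inn}(P)\to\mathrm{Inn}(Q)$,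 where $f_*(\varphi)$ is the unique element of $\mathrm{Inn}(Q)$ with $f\circ\varphi=f_*(\varphi)\circ f$; $f$ is called rigid if it is surjective and $f_*$ is an isomorphism (equivalently $\ker f_*$ is trivial). *)

theory Defs
  imports "HOL-Algebra.Algebra"
begin

text \<open>Quandles are carrier-based in the style of HOL-Algebra; \<open>smap Q x y\<close> is $s_x(y)$.\<close>

record 'a quandle = "'a partial_object" +
  smap :: "'a \<Rightarrow> 'a \<Rightarrow> 'a"

locale quandle =
  fixes Q (structure)
  assumes bij: "x \<in> carrier Q \<Longrightarrow> bij_betw (smap Q x) (carrier Q) (carrier Q)"
    and fixed: "x \<in> carrier Q \<Longrightarrow> smap Q x x = x"
    and distrib: "\<lbrakk>x \<in> carrier Q; y \<in> carrier Q; z \<in> carrier Q\<rbrakk>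
      \<Longrightarrow> smap Q x (smap Q y z) = smap Q (smap Q x y) (smap Q x z)"

locale quandle_hom = P: quandle P + Q: quandle Q
  for P :: "('a, 'c) quandle_scheme" and Q :: "('b, 'd) quandle_scheme" and f :: "'a \<Rightarrow> 'b" +
  assumes closed: "f \<in> carrier P \<rightarrow> carrier Q"
    and hom: "\<lbrakk>x \<in> carrier P; y \<in> carrier P\<rbrakk>
      \<Longrightarrow> f (smap P x y) = smap Q (f x) (f y)"

text \<open>As with \<^const>\<open>AutoGroup\<close>, automorphisms are extensional functions on the carrier.\<close>

definition Aut :: "('a, 'c) quandle_scheme \<Rightarrow> ('a \<Rightarrow> 'a) monoid" where
  "Aut P = BijGroup (carrier P)
     \<lparr>carrier := {\<phi> \<in> Bij (carrier P). quandle_hom P P \<phi>}\<rparr>"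

definition Inn :: "('a, 'c) quandle_scheme \<Rightarrow> ('a \<Rightarrow> 'a) monoid" where
  "Inn P = (Aut P)
     \<lparr>carrier := generate (Aut P) {restrict (smap P x) (carrier P) | x. x \<in> carrier P}\<rparr>"

definition Aut_rel :: "('a, 'c) quandle_scheme \<Rightarrow> ('a \<Rightarrow> 'b) \<Rightarrow> ('a \<Rightarrow> 'a) monoid" where
  "Aut_rel P f = (Aut P)
     \<lparr>carrier := {\<phi> \<in> carrier (Aut P). \<forall>x \<in> carrier P. f (\<phi> x) = f x}\<rparr>"

definition fibre :: "('a, 'c) quandle_scheme \<Rightarrow> ('a \<Rightarrow> 'b) \<Rightarrow> 'b \<Rightarrow> 'a set" where
  "fibre P f q = {x \<in> carrier P. f x = q}"

definition homogeneous ::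
  "('a, 'c) quandle_scheme \<Rightarrow> ('b, 'd) quandle_scheme \<Rightarrow> ('a \<Rightarrow> 'b) \<Rightarrow> bool" where
  "homogeneous P Q f \<longleftrightarrow> quandle_hom P Q f \<and> f ` carrier P = carrier Q \<and>
     (\<forall>q \<in> carrier Q.
        transitive_action (Aut_rel P f) (fibre P f q) (\<lambda>\<phi>. restrict \<phi> (fibre P f q)))"

definition quotient_map :: "('a \<Rightarrow> 'a) monoid \<Rightarrow> 'a \<Rightarrow> 'a set" where
  "quotient_map G x = orbit G (\<lambda>\<phi>. \<phi>) x"

text \<open>The union below is the single orbit of \<open>smap P x y\<close> whenever that orbit does not depend
  on the representatives, in particular when \<open>G\<close> is normalized by \<open>Inn P\<close>.\<close>

definition quandle_quotient :: "('a, 'c) quandle_scheme \<Rightarrow> ('a \<Rightarrow> 'a) monoid \<Rightarrow> 'a set quandle" where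
  "quandle_quotient P G =
     \<lparr>carrier = orbits G (carrier P) (\<lambda>\<phi>. \<phi>),
      smap = \<lambda>A B. \<Union>x\<in>A. \<Union>y\<in>B. quotient_map G (smap P x y)\<rparr>"

definition induced ::
  "('a, 'c) quandle_scheme \<Rightarrow> ('b, 'd) quandle_scheme \<Rightarrow> ('a \<Rightarrow> 'b) \<Rightarrow> ('a \<Rightarrow> 'a) \<Rightarrow> 'b \<Rightarrow> 'b" where
  "induced P Q f \<phi> =
     (THE \<psi>. \<psi> \<in> carrier (Inn Q) \<and> (\<forall>x \<in> carrier P. f (\<phi> x) = \<psi> (f x)))"

definition rigid ::
  "('a, 'c) quandle_scheme \<Rightarrow> ('b, 'd) quandle_scheme \<Rightarrow> ('a \<Rightarrow> 'b) \<Rightarrow> bool" where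
  "rigid P Q f \<longleftrightarrow> quandle_hom P Q f \<and> f ` carrier P = carrier Q \<and>
     induced P Q f \<in> iso (Inn P) (Inn Q)"

end

theory Submission
  imports Defs
begin

text \<open>Inner automorphisms of \<open>P\<close> permute the fibres of \<open>f\<close>, so \<open>Aut_rel P f\<close> is normalized by
  \<open>Inn P\<close>. The quotient map by any normalized \<open>G\<close> is homogeneous, because its fibres are the orbits
  of \<open>G\<close> and \<open>G\<close> is contained in its relative automorphism group. For rigidity of \<open>h\<close>, lift an
  element \<open>\<psi>\<close> of the kernel of \<open>h\<^sub>*\<close> to some \<open>\<phi>\<close> in \<open>Inn P\<close>. Then \<open>f \<circ> \<phi> = f\<close>, so \<open>\<phi>\<close> lies in
  \<open>Aut_rel P f\<close> and fixes every orbit, hence \<open>\<psi>\<close> is the identity.\<close>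

subsection \<open>Automorphism groups\<close>

context quandle
begin

lemma smap_closed: "\<lbrakk>x \<in> carrier Q; y \<in> carrier Q\<rbrakk> \<Longrightarrow> smap Q x y \<in> carrier Q"
  using bij by (blast dest: bij_betwE)

text \<open>Members of \<open>Bij\<close> map the carrier to itself and the quandle axioms hold in
  this context, so of \<open>quandle_hom\<close> only compatibility with \<open>smap\<close>
  remains.\<close>

lemma Aut_mem_iff:
  "\<phi> \<in> carrier (Aut Q) \<longleftrightarrow> \<phi> \<in> Bij (carrier Q) \<and>
     (\<forall>x\<in>carrier Q. \<forall>y\<in>carrier Q. \<phi> (smap Q x y) = smap Q (\<phi> x) (\<phi> y))"
  by (auto simp: Aut_def quandle_hom_def quandle_hom_axioms_def quandle_axioms
      Bij_imp_funcset[THEN funcset_mem])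

lemma subgroup_Aut: "subgroup (carrier (Aut Q)) (BijGroup (carrier Q))"
proof (rule subgroup.intro)
  show "carrier (Aut Q) \<subseteq> carrier (BijGroup (carrier Q))"
    by (auto simp: Aut_mem_iff BijGroup_def)
next
  fix \<phi> \<psi> assume "\<phi> \<in> carrier (Aut Q)" "\<psi> \<in> carrier (Aut Q)"
  then show "\<phi> \<otimes>\<^bsub>BijGroup (carrier Q)\<^esub> \<psi> \<in> carrier (Aut Q)"
    by (auto simp: Aut_mem_iff BijGroup_def compose_Bij compose_eq smap_closed
        Bij_imp_funcset[THEN funcset_mem])
next
  show "\<one>\<^bsub>BijGroup (carrier Q)\<^esub> \<in> carrier (Aut Q)"
    by (auto simp: Aut_mem_iff BijGroup_def id_Bij smap_closed)
next
  fix \<phi> assume \<phi>: "\<phi> \<in> carrier (Aut Q)"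
  then have "inv_into (carrier Q) \<phi> (smap Q x y)
      = smap Q (inv_into (carrier Q) \<phi> x) (inv_into (carrier Q) \<phi> y)"
    if "x \<in> carrier Q" "y \<in> carrier Q" for x y
    using that smap_closed by (intro Bij_inv_into_lemma) (auto simp: Aut_mem_iff)
  with \<phi> show "inv\<^bsub>BijGroup (carrier Q)\<^esub> \<phi> \<in> carrier (Aut Q)"
    by (auto simp: Aut_mem_iff inv_BijGroup restrict_inv_into_Bij smap_closed Bij_inv_into_mem)
qed

text \<open>The form in which \<open>subgroup.subgroup_is_group\<close> delivers a group; it also
  reduces products and units to those of \<open>BijGroup\<close>.\<close>

lemma Aut_eq: "Aut Q = BijGroup (carrier Q) \<lparr>carrier := carrier (Aut Q)\<rparr>"
  by (simp add: Aut_def)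

sublocale Aut: group "Aut Q"
  by (subst Aut_eq) (rule subgroup.subgroup_is_group[OF subgroup_Aut group_BijGroup])

lemma Aut_Bij: "\<phi> \<in> carrier (Aut Q) \<Longrightarrow> \<phi> \<in> Bij (carrier Q)"
  by (simp add: Aut_mem_iff)

lemma Aut_closed: "\<lbrakk>\<phi> \<in> carrier (Aut Q); x \<in> carrier Q\<rbrakk> \<Longrightarrow> \<phi> x \<in> carrier Q"
  using Bij_imp_funcset[OF Aut_Bij] by blast

lemma Aut_hom:
  "\<lbrakk>\<phi> \<in> carrier (Aut Q); x \<in> carrier Q; y \<in> carrier Q\<rbrakk>
    \<Longrightarrow> \<phi> (smap Q x y) = smap Q (\<phi> x) (\<phi> y)"
  by (simp add: Aut_mem_iff)

text \<open>Automorphisms are extensional, so their values off the carrier agree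
  automatically.\<close>

lemma Aut_eqI:
  assumes "\<phi> \<in> carrier (Aut Q)" "\<psi> \<in> carrier (Aut Q)"
    and "\<And>x. x \<in> carrier Q \<Longrightarrow> \<phi> x = \<psi> x"
  shows "\<phi> = \<psi>"
  using assms by (meson Aut_Bij Bij_imp_extensional extensionalityI)

lemma Aut_mult:
  "\<lbrakk>\<phi> \<in> carrier (Aut Q); \<psi> \<in> carrier (Aut Q); x \<in> carrier Q\<rbrakk>
    \<Longrightarrow> (\<phi> \<otimes>\<^bsub>Aut Q\<^esub> \<psi>) x = \<phi> (\<psi> x)"
  using Aut_Bij by (subst Aut_eq) (simp add: BijGroup_def compose_eq)

lemma Aut_one: "x \<in> carrier Q \<Longrightarrow> \<one>\<^bsub>Aut Q\<^esub> x = x"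
  by (subst Aut_eq) (simp add: BijGroup_def)

lemma Aut_inv_left:
  "\<lbrakk>\<phi> \<in> carrier (Aut Q); x \<in> carrier Q\<rbrakk> \<Longrightarrow> (inv\<^bsub>Aut Q\<^esub> \<phi>) (\<phi> x) = x"
  by (metis Aut.inv_closed Aut.l_inv Aut_mult Aut_one)

lemma Aut_inv_right:
  "\<lbrakk>\<phi> \<in> carrier (Aut Q); x \<in> carrier Q\<rbrakk> \<Longrightarrow> \<phi> ((inv\<^bsub>Aut Q\<^esub> \<phi>) x) = x"
  by (metis Aut.inv_closed Aut.r_inv Aut_mult Aut_one)

text \<open>Self-distributivity is precisely the statement that each \<open>smap Q x\<close> is an
  endomorphism.\<close>

lemma inner_Aut: "x \<in> carrier Q \<Longrightarrow> restrict (smap Q x) (carrier Q) \<in> carrier (Aut Q)"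
  by (auto simp: Aut_mem_iff Bij_def bij smap_closed intro: distrib)

lemma inner_subset:
  "{restrict (smap Q x) (carrier Q) | x. x \<in> carrier Q} \<subseteq> carrier (Aut Q)"
  using inner_Aut by blast

lemma subgroup_Inn: "subgroup (carrier (Inn Q)) (Aut Q)"
  using Aut.generate_is_subgroup[OF inner_subset] by (simp add: Inn_def)

lemma Inn_eq: "Inn Q = Aut Q \<lparr>carrier := carrier (Inn Q)\<rparr>"
  by (simp add: Inn_def)

sublocale Inn: group "Inn Q"
  by (subst Inn_eq) (rule subgroup.subgroup_is_group[OF subgroup_Inn Aut.group_axioms])

lemma Inn_Aut: "\<phi> \<in> carrier (Inn Q) \<Longrightarrow> \<phi> \<in> carrier (Aut Q)"
  using subgroup.subset[OF subgroup_Inn] by blast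

lemma Inn_mult: "\<phi> \<otimes>\<^bsub>Inn Q\<^esub> \<psi> = \<phi> \<otimes>\<^bsub>Aut Q\<^esub> \<psi>"
  by (simp add: Inn_def)

lemma Inn_one: "\<one>\<^bsub>Inn Q\<^esub> = \<one>\<^bsub>Aut Q\<^esub>"
  by (simp add: Inn_def)

text \<open>Intended for fibres. Stability of \<open>E\<close> under \<open>H\<close> includes
  stability under inverses, so each member of \<open>H\<close> permutes \<open>E\<close>. The
  restriction makes it extensional on \<open>E\<close>, as \<open>BijGroup E\<close>
  demands.\<close>

lemma group_action_Aut_subgroup:
  assumes H: "subgroup H (Aut Q)" and E: "E \<subseteq> carrier Q"
    and stable: "\<And>\<phi> x. \<lbrakk>\<phi> \<in> H; x \<in> E\<rbrakk> \<Longrightarrow> \<phi> x \<in> E"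
  shows "group_action (Aut Q \<lparr>carrier := H\<rparr>) E (\<lambda>\<phi>. restrict \<phi> E)"
proof -
  have sub: "H \<subseteq> carrier (Aut Q)"
    using H by (rule subgroup.subset)
  have Bij: "restrict \<phi> E \<in> Bij E" if "\<phi> \<in> H" for \<phi>
  proof -
    have "bij_betw \<phi> E E"
      using that E sub subgroup.m_inv_closed[OF H that] stable
      by (intro bij_betwI[where g = "inv\<^bsub>Aut Q\<^esub> \<phi>"]) (auto simp: subset_iff Aut_inv_left Aut_inv_right)
    then show ?thesis
      by (simp add: Bij_def)
  qed
  have "restrict (\<phi> \<otimes>\<^bsub>Aut Q\<^esub> \<psi>) E = compose E (restrict \<phi> E) (restrict \<psi> E)"
    if "\<phi> \<in> H" "\<psi> \<in> H" for \<phi> \<psi>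
    using that E sub stable by (auto simp: compose_def Aut_mult subset_iff)
  then have "(\<lambda>\<phi>. restrict \<phi> E) \<in> hom (Aut Q \<lparr>carrier := H\<rparr>) (BijGroup E)"
    using Bij by (auto simp: hom_def BijGroup_def)
  then show ?thesis
    using subgroup.subgroup_is_group[OF H Aut.group_axioms] group_BijGroup
    by (auto simp: group_action_def group_hom_def group_hom_axioms_def)
qed

end

subsection \<open>The homomorphism of inner automorphism groups\<close>

lemma (in quandle_hom) f_closed: "x \<in> carrier P \<Longrightarrow> f x \<in> carrier Q"
  using closed by blast

locale quandle_epi = quandle_hom P Q f
  for P :: "('a, 'c) quandle_scheme" and Q :: "('b, 'd) quandle_scheme" and f :: "'a \<Rightarrow> 'b" +
  assumes surj: "f ` carrier P = carrier Q"
begin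

text \<open>The defining relation of the induced homomorphism, kept separate from the description
  operator in \<open>induced\<close> so that partners can be found by induction over generated
  elements in either direction.\<close>

definition intertwines :: "('a \<Rightarrow> 'a) \<Rightarrow> ('b \<Rightarrow> 'b) \<Rightarrow> bool" where
  "intertwines \<phi> \<psi> \<longleftrightarrow> (\<forall>x \<in> carrier P. f (\<phi> x) = \<psi> (f x))"

text \<open>Every point of \<open>Q\<close> is some \<open>f x\<close>, where the relation
  prescribes the value.\<close>

lemma intertwines_unique:
  assumes "\<psi> \<in> carrier (Aut Q)" "\<psi>' \<in> carrier (Aut Q)" "intertwines \<phi> \<psi>" "intertwines \<phi> \<psi>'"
  shows "\<psi> = \<psi>'"
proof (rule Q.Aut_eqI[OF assms(1,2)])
  fix y assume "y \<in> carrier Q"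
  then obtain x where "x \<in> carrier P" "y = f x"
    using surj by blast
  with assms(3,4) show "\<psi> y = \<psi>' y"
    by (metis intertwines_def)
qed

lemma intertwines_inner:
  "x \<in> carrier P \<Longrightarrow>
    intertwines (restrict (smap P x) (carrier P)) (restrict (smap Q (f x)) (carrier Q))"
  by (auto simp: intertwines_def hom f_closed)

lemma intertwines_one: "intertwines \<one>\<^bsub>Aut P\<^esub> \<one>\<^bsub>Aut Q\<^esub>"
  by (simp add: intertwines_def P.Aut_one Q.Aut_one f_closed)

lemma intertwines_mult:
  assumes "\<phi> \<in> carrier (Aut P)" "\<phi>' \<in> carrier (Aut P)" "\<psi> \<in> carrier (Aut Q)" "\<psi>' \<in> carrier (Aut Q)"
    and "intertwines \<phi> \<psi>" "intertwines \<phi>' \<psi>'"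
  shows "intertwines (\<phi> \<otimes>\<^bsub>Aut P\<^esub> \<phi>') (\<psi> \<otimes>\<^bsub>Aut Q\<^esub> \<psi>')"
  using assms by (auto simp: intertwines_def P.Aut_mult Q.Aut_mult f_closed P.Aut_closed)

text \<open>Writing \<open>x\<close> as \<open>\<phi> y\<close> turns the claim into the given
  relation at \<open>y\<close>, with \<open>\<psi>\<close> cancelled by its inverse.\<close>

lemma intertwines_inv:
  assumes "\<phi> \<in> carrier (Aut P)" "\<psi> \<in> carrier (Aut Q)" "intertwines \<phi> \<psi>"
  shows "intertwines (inv\<^bsub>Aut P\<^esub> \<phi>) (inv\<^bsub>Aut Q\<^esub> \<psi>)"
  unfolding intertwines_def
proof
  fix x assume x: "x \<in> carrier P"
  define y where "y = (inv\<^bsub>Aut P\<^esub> \<phi>) x"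
  have y: "y \<in> carrier P" "x = \<phi> y"
    using x assms by (auto simp: y_def P.Aut_inv_right P.Aut_closed)
  then have "(inv\<^bsub>Aut Q\<^esub> \<psi>) (f x) = (inv\<^bsub>Aut Q\<^esub> \<psi>) (\<psi> (f y))"
    using assms by (simp add: intertwines_def)
  then show "f ((inv\<^bsub>Aut P\<^esub> \<phi>) x) = (inv\<^bsub>Aut Q\<^esub> \<psi>) (f x)"
    using assms y by (simp add: Q.Aut_inv_left P.Aut_inv_left f_closed)
qed

text \<open>Induction over the generated subgroup: the generator at \<open>x\<close> is matched by
  the generator at \<open>f x\<close>, and matching respects units, inverses and products. This is
  the existence half of the well-definedness of \<open>induced\<close>.\<close>

lemma Inn_push:
  assumes "\<phi> \<in> carrier (Inn P)"
  shows "\<exists>\<psi> \<in> carrier (Inn Q). intertwines \<phi> \<psi>"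
proof -
  let ?A = "{restrict (smap P x) (carrier P) | x. x \<in> carrier P}"
  let ?B = "{restrict (smap Q x) (carrier Q) | x. x \<in> carrier Q}"
  have "\<phi> \<in> generate (Aut P) ?A"
    using assms by (simp add: Inn_def)
  then have "\<exists>\<psi> \<in> generate (Aut Q) ?B. intertwines \<phi> \<psi>"
  proof induction
    case one
    then show ?case
      using intertwines_one generate.one by blast
  next
    case (incl h)
    then show ?case
      using intertwines_inner f_closed generate.incl[of _ ?B] by blast
  next
    case (inv h)
    then obtain x where "x \<in> carrier P" "h = restrict (smap P x) (carrier P)"
      by blast
    then show ?case
      using intertwines_inv[OF P.inner_Aut Q.inner_Aut intertwines_inner] f_closed
        generate.inv[of _ ?B] by blast
  next
    case (eng h1 h2)
    then obtain k1 k2 where k: "k1 \<in> generate (Aut Q) ?B" "intertwines h1 k1"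
      "k2 \<in> generate (Aut Q) ?B" "intertwines h2 k2"
      by blast
    with eng have "intertwines (h1 \<otimes>\<^bsub>Aut P\<^esub> h2) (k1 \<otimes>\<^bsub>Aut Q\<^esub> k2)"
      by (intro intertwines_mult P.Aut.generate_in_carrier[OF P.inner_subset]
          Q.Aut.generate_in_carrier[OF Q.inner_subset])
    with k show ?case
      using generate.eng[of k1 "Aut Q" ?B k2] by blast
  qed
  then show ?thesis
    by (simp add: Inn_def)
qed

text \<open>The same induction run from \<open>Q\<close> back to \<open>P\<close>; it yields
  surjectivity of the induced map.\<close>

lemma Inn_lift:
  assumes "\<psi> \<in> carrier (Inn Q)"
  shows "\<exists>\<phi> \<in> carrier (Inn P). intertwines \<phi> \<psi>"
proof -
  let ?A = "{restrict (smap P x) (carrier P) | x. x \<in> carrier P}"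
  let ?B = "{restrict (smap Q x) (carrier Q) | x. x \<in> carrier Q}"
  have "\<psi> \<in> generate (Aut Q) ?B"
    using assms by (simp add: Inn_def)
  then have "\<exists>\<phi> \<in> generate (Aut P) ?A. intertwines \<phi> \<psi>"
  proof induction
    case one
    then show ?case
      using intertwines_one generate.one by blast
  next
    case (incl h)
    \<comment> \<open>Surjectivity of \<open>f\<close> provides a point of \<open>P\<close> over the
      base point of the generator.\<close>
    then obtain x where x: "x \<in> carrier P" and h: "h = restrict (smap Q (f x)) (carrier Q)"
      unfolding surj[symmetric] by auto
    have "restrict (smap P x) (carrier P) \<in> generate (Aut P) ?A"
      using x by (blast intro: generate.incl)
    then show ?case
      using intertwines_inner[OF x] h by blast
  next
    case (inv h)
    then obtain x where x: "x \<in> carrier P" and h: "h = restrict (smap Q (f x)) (carrier Q)"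
      unfolding surj[symmetric] by auto
    have "inv\<^bsub>Aut P\<^esub> restrict (smap P x) (carrier P) \<in> generate (Aut P) ?A"
      using x by (blast intro: generate.inv)
    then show ?case
      using intertwines_inv[OF P.inner_Aut Q.inner_Aut intertwines_inner] x f_closed h by blast
  next
    case (eng h1 h2)
    then obtain k1 k2 where k: "k1 \<in> generate (Aut P) ?A" "intertwines k1 h1"
      "k2 \<in> generate (Aut P) ?A" "intertwines k2 h2"
      by blast
    with eng have "intertwines (k1 \<otimes>\<^bsub>Aut P\<^esub> k2) (h1 \<otimes>\<^bsub>Aut Q\<^esub> h2)"
      by (intro intertwines_mult P.Aut.generate_in_carrier[OF P.inner_subset]
          Q.Aut.generate_in_carrier[OF Q.inner_subset])
    with k show ?case
      using generate.eng[of k1 "Aut P" ?A k2] by blast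
  qed
  then show ?thesis
    by (simp add: Inn_def)
qed

lemma induced_eqI:
  assumes "\<psi> \<in> carrier (Inn Q)" "intertwines \<phi> \<psi>"
  shows "induced P Q f \<phi> = \<psi>"
  unfolding induced_def
  using assms intertwines_unique Q.Inn_Aut
  by (intro the_equality) (auto simp: intertwines_def)

lemma induced_intertwines:
  assumes "\<phi> \<in> carrier (Inn P)"
  shows "induced P Q f \<phi> \<in> carrier (Inn Q)" "intertwines \<phi> (induced P Q f \<phi>)"
  using Inn_push[OF assms] induced_eqI by auto

lemma induced_hom: "induced P Q f \<in> hom (Inn P) (Inn Q)"
proof (rule homI)
  fix \<phi> \<phi>' assume \<phi>: "\<phi> \<in> carrier (Inn P)" "\<phi>' \<in> carrier (Inn P)"
  show "induced P Q f (\<phi> \<otimes>\<^bsub>Inn P\<^esub> \<phi>') = induced P Q f \<phi> \<otimes>\<^bsub>Inn Q\<^esub> induced P Q f \<phi>'"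
    using \<phi> induced_intertwines
    by (intro induced_eqI Q.Inn.m_closed)
      (auto simp: P.Inn_mult Q.Inn_mult intro!: intertwines_mult P.Inn_Aut Q.Inn_Aut)
qed (rule induced_intertwines)

lemma induced_surj: "induced P Q f ` carrier (Inn P) = carrier (Inn Q)"
proof
  show "carrier (Inn Q) \<subseteq> induced P Q f ` carrier (Inn P)"
  proof
    fix \<psi> assume "\<psi> \<in> carrier (Inn Q)"
    then obtain \<phi> where "\<phi> \<in> carrier (Inn P)" "induced P Q f \<phi> = \<psi>"
      using Inn_lift induced_eqI by blast
    then show "\<psi> \<in> induced P Q f ` carrier (Inn P)"
      by blast
  qed
qed (use induced_intertwines in blast)

text \<open>The induced map is always a surjective group homomorphism, so only its kernel matters;
  being in the kernel means \<open>f \<circ> \<phi> = f\<close> on the carrier.\<close>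

lemma rigidI:
  assumes ker: "\<And>\<phi>. \<lbrakk>\<phi> \<in> carrier (Inn P); \<And>x. x \<in> carrier P \<Longrightarrow> f (\<phi> x) = f x\<rbrakk>
    \<Longrightarrow> \<phi> = \<one>\<^bsub>Inn P\<^esub>"
  shows "rigid P Q f"
proof -
  interpret induced: group_hom "Inn P" "Inn Q" "induced P Q f"
    using induced_hom by unfold_locales
  have "\<phi> = \<one>\<^bsub>Inn P\<^esub>" if \<phi>: "\<phi> \<in> carrier (Inn P)" "induced P Q f \<phi> = \<one>\<^bsub>Inn Q\<^esub>" for \<phi>
  proof (rule ker[OF \<phi>(1)])
    show "f (\<phi> x) = f x" if "x \<in> carrier P" for x
      using induced_intertwines(2)[OF \<phi>(1)] that \<phi>(2)
      by (simp add: intertwines_def Q.Inn_one Q.Aut_one f_closed)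
  qed
  then have "induced P Q f \<in> iso (Inn P) (Inn Q)"
    using induced_surj by (auto intro!: induced.iso_iff[THEN iffD2])
  then show ?thesis
    by (simp add: rigid_def quandle_hom_axioms surj)
qed

end

section \<open>Relative automorphism groups and their normalization\<close>

lemma (in quandle) subgroup_Aut_rel: "subgroup (carrier (Aut_rel Q f)) (Aut Q)"
proof (rule Aut.subgroupI)
  show "carrier (Aut_rel Q f) \<noteq> {}"
    using Aut_one by (auto simp: Aut_rel_def intro!: exI[of _ "\<one>\<^bsub>Aut Q\<^esub>"])
next
  fix \<phi> assume "\<phi> \<in> carrier (Aut_rel Q f)"
  then have \<phi>: "\<phi> \<in> carrier (Aut Q)" "\<And>x. x \<in> carrier Q \<Longrightarrow> f (\<phi> x) = f x"
    by (auto simp: Aut_rel_def)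
  then have "f ((inv\<^bsub>Aut Q\<^esub> \<phi>) x) = f x" if "x \<in> carrier Q" for x
    using that by (metis Aut_closed Aut.inv_closed Aut_inv_right)
  with \<phi> show "inv\<^bsub>Aut Q\<^esub> \<phi> \<in> carrier (Aut_rel Q f)"
    by (simp add: Aut_rel_def)
qed (auto simp: Aut_rel_def Aut_mult Aut_closed)

text \<open>Read from right to left, this recovers \<open>Aut_rel P f\<close> from
  \<open>Aut P\<close> with replaced carrier, the shape used for general subgroups.\<close>

lemma Aut_rel_eq: "Aut_rel P f = Aut P \<lparr>carrier := carrier (Aut_rel P f)\<rparr>"
  by (simp add: Aut_rel_def)

text \<open>For \<open>x = \<sigma> y\<close>, the value of \<open>f\<close> at
  \<open>\<sigma> (\<phi> y)\<close> depends only on \<open>f (\<phi> y) = f y\<close>, hence equals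
  \<open>f (\<sigma> y)\<close>.\<close>

lemma (in quandle_epi) Aut_rel_normalized:
  assumes \<sigma>: "\<sigma> \<in> carrier (Inn P)" and \<phi>: "\<phi> \<in> carrier (Aut_rel P f)"
  shows "\<sigma> \<otimes>\<^bsub>Aut P\<^esub> \<phi> \<otimes>\<^bsub>Aut P\<^esub> inv\<^bsub>Aut P\<^esub> \<sigma> \<in> carrier (Aut_rel P f)"
proof -
  have Aut: "\<sigma> \<in> carrier (Aut P)" "\<phi> \<in> carrier (Aut P)"
    using \<sigma> \<phi> P.Inn_Aut by (auto simp: Aut_rel_def)
  obtain \<psi> where \<psi>: "intertwines \<sigma> \<psi>"
    using Inn_push[OF \<sigma>] by blast
  have "f ((\<sigma> \<otimes>\<^bsub>Aut P\<^esub> \<phi> \<otimes>\<^bsub>Aut P\<^esub> inv\<^bsub>Aut P\<^esub> \<sigma>) x) = f x" if x: "x \<in> carrier P" for x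
  proof -
    define y where "y = (inv\<^bsub>Aut P\<^esub> \<sigma>) x"
    have y: "y \<in> carrier P" "\<sigma> y = x"
      using Aut x by (simp_all add: y_def P.Aut_closed P.Aut_inv_right)
    have "f ((\<sigma> \<otimes>\<^bsub>Aut P\<^esub> \<phi> \<otimes>\<^bsub>Aut P\<^esub> inv\<^bsub>Aut P\<^esub> \<sigma>) x) = f (\<sigma> (\<phi> y))"
      using Aut x y by (simp add: P.Aut_mult flip: y_def)
    also have "\<dots> = \<psi> (f y)"
      using \<psi> \<phi> Aut y by (simp add: intertwines_def Aut_rel_def P.Aut_closed)
    also have "\<dots> = f x"
      using \<psi> y by (auto simp: intertwines_def)
    finally show ?thesis .
  qed
  then show ?thesis
    using Aut by (simp add: Aut_rel_def)
qed

subsection \<open>Quotients by normalized subgroups\<close>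

text \<open>Inclusion of every conjugate in \<open>H\<close> amounts to equality, because the
  inverse of \<open>\<sigma>\<close> is inner too.\<close>

locale normalized_subgroup = quandle P for P :: "('a, 'c) quandle_scheme" +
  fixes H :: "('a \<Rightarrow> 'a) set"
  assumes subgroup: "subgroup H (Aut P)"
    and normalized: "\<lbrakk>\<sigma> \<in> carrier (Inn P); \<phi> \<in> H\<rbrakk>
      \<Longrightarrow> \<sigma> \<otimes>\<^bsub>Aut P\<^esub> \<phi> \<otimes>\<^bsub>Aut P\<^esub> inv\<^bsub>Aut P\<^esub> \<sigma> \<in> H"
begin

abbreviation "G \<equiv> Aut P \<lparr>carrier := H\<rparr>"
abbreviation "\<pi> \<equiv> quotient_map G"
abbreviation "PG \<equiv> quandle_quotient P G"

lemma H_Aut: "\<phi> \<in> H \<Longrightarrow> \<phi> \<in> carrier (Aut P)"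
  using subgroup.subset[OF subgroup] by blast

text \<open>\<open>G\<close> multiplies as \<open>BijGroup (carrier P)\<close> does, so the identity
  map is an action; this opens up the library theory of orbits.\<close>

sublocale act: group_action G "carrier P" "\<lambda>\<phi>. \<phi>"
proof -
  have "(\<lambda>\<phi>. \<phi>) \<in> hom G (BijGroup (carrier P))"
  proof (rule homI)
    show "\<phi> \<in> carrier (BijGroup (carrier P))" if "\<phi> \<in> carrier G" for \<phi>
      using that Aut_Bij[OF H_Aut] by (simp add: BijGroup_def)
  qed (simp add: Aut_def)
  then show "group_action G (carrier P) (\<lambda>\<phi>. \<phi>)"
    using subgroup.subgroup_is_group[OF subgroup Aut.group_axioms] group_BijGroup
    by (auto simp: group_action_def group_hom_def group_hom_axioms_def)
qed

lemma mem_\<pi>: "y \<in> \<pi> x \<longleftrightarrow> (\<exists>\<phi>\<in>H. y = \<phi> x)"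
  by (auto simp: quotient_map_def orbit_def)

lemma self_mem_\<pi>: "x \<in> carrier P \<Longrightarrow> x \<in> \<pi> x"
  unfolding quotient_map_def by (rule act.orbit_refl)

text \<open>Orbits are equal or disjoint, and \<open>y\<close> lies in its own orbit.\<close>

lemma \<pi>_eq_iff:
  assumes "x \<in> carrier P" "y \<in> carrier P"
  shows "\<pi> x = \<pi> y \<longleftrightarrow> (\<exists>\<phi>\<in>H. y = \<phi> x)"
proof -
  have "\<pi> x \<in> orbits G (carrier P) (\<lambda>\<phi>. \<phi>)" "\<pi> y \<in> orbits G (carrier P) (\<lambda>\<phi>. \<phi>)"
    using assms unfolding orbits_def quotient_map_def by blast+
  then have "\<pi> x = \<pi> y \<or> \<pi> x \<inter> \<pi> y = {}"
    by (rule act.disjoint_union)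
  then have "\<pi> x = \<pi> y \<longleftrightarrow> y \<in> \<pi> x"
    using self_mem_\<pi>[OF assms(2)] by blast
  then show ?thesis
    by (simp only: mem_\<pi>)
qed

lemma carrier_PG: "carrier PG = \<pi> ` carrier P"
  by (auto simp: quandle_quotient_def orbits_def quotient_map_def)

lemma inner_Inn: "x \<in> carrier P \<Longrightarrow> restrict (smap P x) (carrier P) \<in> carrier (Inn P)"
  by (auto simp: Inn_def intro: generate.incl)

text \<open>Well-definedness of the quotient operation. Pulling \<open>\<phi>\<close> out leaves
  \<open>\<mu>\<close> acting on the second argument, and normalization moves \<open>\<mu>\<close>
  past the inner automorphism at \<open>x\<close> as its conjugate \<open>\<kappa>\<close>.\<close>

lemma \<pi>_smap_cong:
  assumes x: "x \<in> carrier P" "x' \<in> \<pi> x" and y: "y \<in> carrier P" "y' \<in> \<pi> y"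
  shows "\<pi> (smap P x' y') = \<pi> (smap P x y)"
proof -
  let ?s = "restrict (smap P x) (carrier P)"
  obtain \<phi> \<psi> where H: "\<phi> \<in> H" "\<psi> \<in> H" and eq: "x' = \<phi> x" "y' = \<psi> y"
    using x y by (auto simp: mem_\<pi>)
  \<comment> \<open>\<open>s (\<phi> x) (\<psi> y) = \<phi> (s x (\<mu> y)) = \<phi> (\<kappa> (s x y))\<close>\<close>
  define \<mu> where "\<mu> = inv\<^bsub>Aut P\<^esub> \<phi> \<otimes>\<^bsub>Aut P\<^esub> \<psi>"
  define \<kappa> where "\<kappa> = ?s \<otimes>\<^bsub>Aut P\<^esub> \<mu> \<otimes>\<^bsub>Aut P\<^esub> inv\<^bsub>Aut P\<^esub> ?s"
  have \<mu>: "\<mu> \<in> H" "\<mu> \<in> carrier (Aut P)"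
    using H subgroup by (auto simp: \<mu>_def subgroup.m_closed subgroup.m_inv_closed H_Aut)
  have \<kappa>: "\<kappa> \<in> H"
    using normalized[OF inner_Inn] x \<mu> by (simp add: \<kappa>_def)
  have s: "?s \<in> carrier (Aut P)"
    using x inner_Aut by blast
  have \<mu>y: "\<mu> y \<in> carrier P" "\<phi> (\<mu> y) = \<psi> y"
    using H y \<mu> by (simp_all add: Aut_closed \<mu>_def Aut_mult Aut_inv_right H_Aut)
  have "\<kappa> (smap P x y) = \<kappa> (?s y)"
    using y by simp
  also have "\<dots> = ?s (\<mu> y)"
    using s \<mu> y Aut_closed[OF s y(1)] Aut_inv_left[OF s y(1)]
    by (simp only: \<kappa>_def Aut_mult Aut.m_closed Aut.inv_closed)
  also have "\<dots> = smap P x (\<mu> y)"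
    using \<mu>y by simp
  finally have "\<phi> (\<kappa> (smap P x y)) = smap P x' y'"
    using H x y \<mu>y by (simp add: Aut_hom H_Aut eq)
  then have "smap P x' y' = (\<phi> \<otimes>\<^bsub>Aut P\<^esub> \<kappa>) (smap P x y)"
    using H \<kappa> x y by (simp add: Aut_mult H_Aut smap_closed)
  moreover have "\<phi> \<otimes>\<^bsub>Aut P\<^esub> \<kappa> \<in> H"
    using H \<kappa> subgroup by (simp add: subgroup.m_closed)
  moreover have "x' \<in> carrier P" "y' \<in> carrier P"
    using H x y by (simp_all add: eq Aut_closed H_Aut)
  ultimately have "\<pi> (smap P x y) = \<pi> (smap P x' y')"
    using \<pi>_eq_iff[OF smap_closed[OF x(1) y(1)] smap_closed] by blast
  then show ?thesis ..
qed

lemma smap_PG: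
  assumes "x \<in> carrier P" "y \<in> carrier P"
  shows "smap PG (\<pi> x) (\<pi> y) = \<pi> (smap P x y)"
proof -
  have "smap PG (\<pi> x) (\<pi> y) = (\<Union>x'\<in>\<pi> x. \<Union>y'\<in>\<pi> y. \<pi> (smap P x' y'))"
    by (simp add: quandle_quotient_def)
  also have "\<dots> = (\<Union>x'\<in>\<pi> x. \<Union>y'\<in>\<pi> y. \<pi> (smap P x y))"
    using assms by (intro SUP_cong refl \<pi>_smap_cong)
  \<comment> \<open>The union of a constant family collapses because both index orbits are
    nonempty.\<close>
  also have "\<dots> = \<pi> (smap P x y)"
    using self_mem_\<pi>[OF assms(1)] self_mem_\<pi>[OF assms(2)] by blast
  finally show ?thesis .
qed

text \<open>If \<open>\<phi>\<close> carries \<open>smap P x y\<close> to \<open>smap P x z\<close>,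
  its conjugate by the inverse of the inner automorphism at \<open>x\<close> carries
  \<open>y\<close> to \<open>z\<close>.\<close>

lemma smap_\<pi>_inj:
  assumes x: "x \<in> carrier P" and y: "y \<in> carrier P" and z: "z \<in> carrier P"
    and eq: "\<pi> (smap P x y) = \<pi> (smap P x z)"
  shows "\<pi> y = \<pi> z"
proof -
  let ?s = "restrict (smap P x) (carrier P)"
  have s: "?s \<in> carrier (Inn P)" "?s \<in> carrier (Aut P)"
    using x inner_Inn inner_Aut by blast+
  obtain \<phi> where \<phi>: "\<phi> \<in> H" "smap P x z = \<phi> (smap P x y)"
    using eq \<pi>_eq_iff[OF smap_closed[OF x y] smap_closed[OF x z]] by blast
  define \<kappa> where "\<kappa> = inv\<^bsub>Aut P\<^esub> ?s \<otimes>\<^bsub>Aut P\<^esub> \<phi> \<otimes>\<^bsub>Aut P\<^esub> ?s"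
  have "inv\<^bsub>Aut P\<^esub> ?s \<in> carrier (Inn P)"
    using s subgroup.m_inv_closed[OF subgroup_Inn] by blast
  \<comment> \<open>Normalization is applied to the inverse of \<open>?s\<close>, whose own inverse
    is \<open>?s\<close> again.\<close>
  from normalized[OF this \<phi>(1)] have "\<kappa> \<in> H"
    using s by (simp only: Aut.inv_inv \<kappa>_def)
  have "\<phi> (?s y) = ?s z"
    using \<phi> y z by simp
  then have "\<kappa> y = (inv\<^bsub>Aut P\<^esub> ?s) (?s z)"
    using s H_Aut[OF \<phi>(1)] y Aut_closed[OF s(2) y]
    by (simp only: \<kappa>_def Aut_mult Aut.m_closed Aut.inv_closed)
  then have "z = \<kappa> y"
    using Aut_inv_left[OF s(2) z] by simp
  with \<open>\<kappa> \<in> H\<close> show ?thesis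
    using y z \<pi>_eq_iff by blast
qed

text \<open>Surjectivity of the maps and both equations descend along the surjection
  \<open>\<pi>\<close>. Injectivity does not descend by itself and comes from
  \<open>smap_\<pi>_inj\<close>.\<close>

lemma quandle_PG: "quandle PG"
proof (rule quandle.intro)
  fix A assume "A \<in> carrier PG"
  then obtain x where x: "x \<in> carrier P" and A: "A = \<pi> x"
    unfolding carrier_PG by blast
  have "inj_on (smap PG A) (carrier PG)"
    unfolding inj_on_def carrier_PG
  proof (intro ballI impI, elim imageE)
    fix B C y z
    assume eq: "smap PG A B = smap PG A C"
      and y: "B = \<pi> y" "y \<in> carrier P" and z: "C = \<pi> z" "z \<in> carrier P"
    have "\<pi> (smap P x y) = \<pi> (smap P x z)"
      using eq unfolding A y(1) z(1) by (simp only: smap_PG x y(2) z(2))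
    then show "B = C"
      unfolding y(1) z(1) by (rule smap_\<pi>_inj[OF x y(2) z(2)])
  qed
  moreover have "smap PG A ` carrier PG = \<pi> ` smap P x ` carrier P"
    unfolding A carrier_PG image_image by (intro image_cong refl smap_PG x)
  then have "smap PG A ` carrier PG = carrier PG"
    unfolding bij_betw_imp_surj_on[OF bij[OF x]] by (simp only: carrier_PG)
  ultimately show "bij_betw (smap PG A) (carrier PG) (carrier PG)"
    by (simp add: bij_betw_def)
  show "smap PG A A = A"
    unfolding A by (simp only: smap_PG fixed x)
next
  fix A B C assume "A \<in> carrier PG" "B \<in> carrier PG" "C \<in> carrier PG"
  then obtain x y z where "x \<in> carrier P" "A = \<pi> x" "y \<in> carrier P" "B = \<pi> y"
    "z \<in> carrier P" "C = \<pi> z"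
    unfolding carrier_PG by blast
  then show "smap PG A (smap PG B C) = smap PG (smap PG A B) (smap PG A C)"
    by (simp only: smap_PG smap_closed distrib[of x y z])
qed

sublocale PG: quandle PG
  by (rule quandle_PG)

text \<open>Makes \<open>Inn_lift\<close> available for the quotient map, as the rigidity argument
  requires.\<close>

sublocale \<pi>: quandle_epi P PG \<pi>
proof unfold_locales
  show "\<pi> \<in> carrier P \<rightarrow> carrier PG"
    unfolding carrier_PG by blast
qed (simp_all only: carrier_PG smap_PG)

lemma homogeneous_\<pi>: "homogeneous P PG \<pi>"
proof -
  let ?R = "carrier (Aut_rel P \<pi>)"
  \<comment> \<open>Members of \<open>H\<close> move points within their orbits. Through this
    inclusion, transitivity of \<open>H\<close> on an orbit passes to \<open>?R\<close>.\<close>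
  have "H \<subseteq> ?R"
  proof
    fix \<phi> assume \<phi>: "\<phi> \<in> H"
    have "\<pi> (\<phi> x) = \<pi> x" if x: "x \<in> carrier P" for x
      using \<pi>_eq_iff[OF x Aut_closed[OF H_Aut[OF \<phi>] x]] \<phi> by blast
    then show "\<phi> \<in> ?R"
      using H_Aut[OF \<phi>] unfolding Aut_rel_def by simp
  qed
  \<comment> \<open>For \<open>A\<close> outside the carrier of \<open>PG\<close> the fibre is empty
    and transitivity is vacuous.\<close>
  have "transitive_action (Aut_rel P \<pi>) (fibre P \<pi> A) (\<lambda>\<phi>. restrict \<phi> (fibre P \<pi> A))" for A
  proof (rule transitive_action.intro)
    have "group_action (Aut P \<lparr>carrier := ?R\<rparr>) (fibre P \<pi> A) (\<lambda>\<phi>. restrict \<phi> (fibre P \<pi> A))"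
    proof (rule group_action_Aut_subgroup[OF subgroup_Aut_rel])
      show "fibre P \<pi> A \<subseteq> carrier P"
        unfolding fibre_def by blast
      show "\<phi> x \<in> fibre P \<pi> A" if "\<phi> \<in> ?R" "x \<in> fibre P \<pi> A" for \<phi> x
        using that Aut_closed[of \<phi> x] by (simp add: Aut_rel_def fibre_def)
    qed
    then show "group_action (Aut_rel P \<pi>) (fibre P \<pi> A) (\<lambda>\<phi>. restrict \<phi> (fibre P \<pi> A))"
      by (simp only: flip: Aut_rel_eq)
    show "transitive_action_axioms (Aut_rel P \<pi>) (fibre P \<pi> A)
      (\<lambda>\<phi>. restrict \<phi> (fibre P \<pi> A))"
    proof
      fix x y assume xy: "x \<in> fibre P \<pi> A" "y \<in> fibre P \<pi> A"
      then have "x \<in> carrier P" "y \<in> carrier P" "\<pi> x = \<pi> y"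
        by (simp_all add: fibre_def)
      then obtain \<phi> where "\<phi> \<in> H" "y = \<phi> x"
        using \<pi>_eq_iff by blast
      then show "\<exists>\<phi>\<in>?R. restrict \<phi> (fibre P \<pi> A) x = y"
        using xy(1) \<open>H \<subseteq> ?R\<close> by (intro bexI[of _ \<phi>]) auto
    qed
  qed
  then show ?thesis
    unfolding homogeneous_def using \<pi>.quandle_hom_axioms \<pi>.surj by blast
qed

end

subsection \<open>The factorization\<close>

context quandle_epi
begin

lemma normalized_subgroup_Aut_rel: "normalized_subgroup P (carrier (Aut_rel P f))"
  by (intro normalized_subgroup.intro normalized_subgroup_axioms.intro P.quandle_axioms
      P.subgroup_Aut_rel Aut_rel_normalized)

interpretation rel: normalized_subgroup P "carrier (Aut_rel P f)"
  by (rule normalized_subgroup_Aut_rel)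

text \<open>The map \<open>h\<close> of the factorization. The image of an orbit under
  \<open>f\<close> is a singleton, so its element is taken without choosing a
  representative.\<close>

definition orbit_value :: "'a set \<Rightarrow> 'b" where
  "orbit_value A = the_elem (f ` A)"

lemma orbit_value_\<pi>: "x \<in> carrier P \<Longrightarrow> orbit_value (rel.\<pi> x) = f x"
proof -
  assume x: "x \<in> carrier P"
  have "x \<in> rel.\<pi> x"
    using x by (rule rel.self_mem_\<pi>)
  moreover have "f y = f x" if "y \<in> rel.\<pi> x" for y
    using that x unfolding rel.mem_\<pi> by (auto simp: Aut_rel_def)
  ultimately have "f ` rel.\<pi> x = {f x}"
    by blast
  then show ?thesis
    by (simp add: orbit_value_def)
qed

lemma quandle_epi_orbit_value: "quandle_epi rel.PG Q orbit_value"
proof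
  show "orbit_value \<in> carrier rel.PG \<rightarrow> carrier Q"
    by (auto simp: rel.carrier_PG orbit_value_\<pi> f_closed)
  show "orbit_value ` carrier rel.PG = carrier Q"
    by (simp add: rel.carrier_PG image_image orbit_value_\<pi> surj)
  show "orbit_value (smap rel.PG A B) = smap Q (orbit_value A) (orbit_value B)"
    if "A \<in> carrier rel.PG" "B \<in> carrier rel.PG" for A B
    using that by (auto simp: rel.carrier_PG rel.smap_PG orbit_value_\<pi> P.smap_closed hom)
qed

interpretation induced_map: quandle_epi rel.PG Q orbit_value
  by (rule quandle_epi_orbit_value)

lemma rigid_orbit_value: "rigid rel.PG Q orbit_value"
proof (rule induced_map.rigidI)
  fix \<psi> assume \<psi>: "\<psi> \<in> carrier (Inn rel.PG)"
    and fix_value: "\<And>A. A \<in> carrier rel.PG \<Longrightarrow> orbit_value (\<psi> A) = orbit_value A"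
  \<comment> \<open>The lift is taken along the quotient map, not along \<open>f\<close>.\<close>
  obtain \<phi> where \<phi>: "\<phi> \<in> carrier (Inn P)" "rel.\<pi>.intertwines \<phi> \<psi>"
    using rel.\<pi>.Inn_lift[OF \<psi>] by blast
  have Aut: "\<phi> \<in> carrier (Aut P)"
    using \<phi> P.Inn_Aut by blast
  have "f (\<phi> x) = f x" if x: "x \<in> carrier P" for x
  proof -
    \<comment> \<open>Apply \<open>orbit_value_\<pi>\<close> at the point \<open>\<phi> x\<close>,
      whose orbit is \<open>\<psi> (rel.\<pi> x)\<close>.\<close>
    have "f (\<phi> x) = orbit_value (\<psi> (rel.\<pi> x))"
      using \<phi>(2) Aut x by (simp add: rel.\<pi>.intertwines_def P.Aut_closed flip: orbit_value_\<pi>)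
    then show ?thesis
      using fix_value x by (simp add: rel.carrier_PG orbit_value_\<pi>)
  qed
  \<comment> \<open>Here it matters that the quotient is by all of \<open>Aut_rel P f\<close>: the
    lift belongs to the very group whose orbits are the points of the quotient.\<close>
  then have "\<phi> \<in> carrier (Aut_rel P f)"
    using Aut by (simp add: Aut_rel_def)
  then have "rel.\<pi> x = \<psi> (rel.\<pi> x)" if "x \<in> carrier P" for x
    using that \<phi>(2) rel.\<pi>_eq_iff[OF that P.Aut_closed[OF Aut that]]
    by (auto simp: rel.\<pi>.intertwines_def)
  then have "\<psi> = \<one>\<^bsub>Aut rel.PG\<^esub>"
    using rel.PG.Inn_Aut[OF \<psi>]
    by (intro rel.PG.Aut_eqI) (auto simp: rel.carrier_PG rel.PG.Aut_one)
  then show "\<psi> = \<one>\<^bsub>Inn rel.PG\<^esub>"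
    by (simp add: rel.PG.Inn_one)
qed

end

theorem proposition2p37:
  fixes P :: "('a, 'c) quandle_scheme" and Q :: "('b, 'd) quandle_scheme" and f :: "'a \<Rightarrow> 'b"
  assumes "quandle_hom P Q f" and "f ` carrier P = carrier Q"
  shows "let G = Aut_rel P f; \<pi> = quotient_map G; PG = quandle_quotient P G in
    quandle_hom P PG \<pi> \<and> \<pi> ` carrier P = carrier PG \<and> homogeneous P PG \<pi> \<and>
    (\<exists>h. quandle_hom PG Q h \<and> h ` carrier PG = carrier Q \<and>
         (\<forall>x \<in> carrier P. f x = h (\<pi> x)) \<and> rigid PG Q h)"
proof -
  interpret quandle_epi P Q f
    using assms by (simp add: quandle_epi_def quandle_epi_axioms_def)
  interpret rel: normalized_subgroup P "carrier (Aut_rel P f)"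
    by (rule normalized_subgroup_Aut_rel)
  interpret induced_map: quandle_epi rel.PG Q orbit_value
    by (rule quandle_epi_orbit_value)
  show ?thesis
    unfolding Let_def
    using rel.\<pi>.quandle_hom_axioms rel.\<pi>.surj rel.homogeneous_\<pi>
      induced_map.quandle_hom_axioms induced_map.surj rigid_orbit_value orbit_value_\<pi>
    unfolding Aut_rel_eq[of P f, symmetric]
    by (intro conjI exI[of _ orbit_value]) auto
qed

end
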